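(* Let $c\in\mathcal{M}_+(\mathbf{Z})$, and let $\phi$, $\mathbf{\Phi}\in\mathbb{R}^{r\times N}$ and $\boldsymbol{\ell}\in\mathbb{R}^N$ be the feature map, data matrix and cost data described in the context. The linear program $$\max_{\alpha\in\mathbb{R}^r}\ \alpha^\top\int_{\mathbf{Z}}\phi(z)\,c(dz)\quad\text{s.t.}\quad \mathbf{\Phi}^\top\alpha\le\boldsymbol{\ell}$$ has a finite optimal value if and only if there exists $\lambda\in\mathbb{R}^N_+$ (i.e. $\lambda\in\mathbb{R}^N$ with nonnegative entries) such that $$\int_{\mathbf{Z}}\phi(z)\,c(dz)=\mathbf{\Phi}\lambda.$$
   Context: Let $\mathbf{X}\subseteq\mathbb{R}^n$, $\mathbf{U}\subseteq\mathbb{R}^m$, $\mathbf{Z}=\mathbf{X}\times\mathbf{U}$. The dynamics are $f:\mathbf{X}\times\mathbf{U}\to\mathbf{X}$, the stage cost is $\ell:\mathbf{X}\times\mathbf{U}\to\mathbb{R}_+$ (nonnegative), and the discount factor is $\gamma\in(0,1)$. For a fixed positive weight function on $\mathbf{Z}$, $\mathcal{S}(\mathbf{Z})$ is the vector space of real-valued measurable functions on $\mathbf{Z}$ with finite weighted sup-norm, and $\mathcal{M}_+(\mathbf{Z})$ is the set of finite nonnegative measures $c$ on $\mathbf{Z}$ with finite weighted total variation and $c(\mathbf{Z})>0$. Basis functions $\phi_1,\dots,\phi_r\in\mathcal{S}(\mathbf{Z})$ are fixed and $\phi(z)=[\phi_1(z)\ \cdots\ \phi_r(z)]^\top\in\mathbb{R}^r$;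 in particular each $\phi_j$ is $c$-integrable for every $c\in\mathcal{M}_+(\mathbf{Z})$. Data: for $i=1,\dots,N$, $z_i=(x_i,u_i)\in\mathbf{Z}$, $x_i^+=f(x_i,u_i)$, $w_i\in\mathbf{U}$, $z_i^+=(x_i^+,w_i)\in\mathbf{Z}$, $\ell_i=\ell(z_i)\ge 0$. The data matrix is $\mathbf{\Phi}=[\phi(z_1)-\gamma\phi(z_1^+)\ \cdots\ \phi(z_N)-\gamma\phi(z_N^+)]\in\mathbb{R}^{r\times N}$ and $\boldsymbol{\ell}=[\ell_1\ \cdots\ \ell_N]^\top$. Vector inequalities are entrywise. *)

theory Defs
  imports "HOL-Analysis.Analysis"
begin

definition weighted_sup_norm :: "'z set \<Rightarrow> ('z \<Rightarrow> real) \<Rightarrow> ('z \<Rightarrow> real) \<Rightarrow> ennreal" where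
  "weighted_sup_norm Z \<omega> g = (SUP z\<in>Z. ennreal (\<bar>g z\<bar> / \<omega> z))"

text \<open>A function on \<open>Z\<close> is represented by a total function; its values outside \<open>Z\<close> are irrelevant.\<close>

definition weighted_functions ::
    "'z::topological_space set \<Rightarrow> ('z \<Rightarrow> real) \<Rightarrow> ('z \<Rightarrow> real) set" where
  "weighted_functions Z \<omega> =
     {g. g \<in> borel_measurable (restrict_space borel Z) \<and> weighted_sup_norm Z \<omega> g < \<infinity>}"

text \<open>A nonnegative measure is its own total variation, so its weighted total variation is the
  integral of the weight.\<close>

definition weighted_measures ::
    "'z::topological_space set \<Rightarrow> ('z \<Rightarrow> real) \<Rightarrow> 'z measure set" where
  "weighted_measures Z \<omega> =
     {c. sets c = sets (restrict_space borel Z) \<and> finite_measure c \<and>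
         (\<integral>\<^sup>+ z. ennreal (\<omega> z) \<partial>c) < \<infinity> \<and> emeasure c Z > 0}"

definition data_matrix ::
    "real \<Rightarrow> ('z \<Rightarrow> real ^ 'r) \<Rightarrow> ('N \<Rightarrow> 'z) \<Rightarrow> ('N \<Rightarrow> 'z) \<Rightarrow> real ^ 'N ^ 'r" where
  "data_matrix \<gamma> \<phi> z zp = (\<chi> j i. (\<phi> (z i) - \<gamma> *\<^sub>R \<phi> (zp i)) $ j)"

definition cost_vector :: "('z \<Rightarrow> real) \<Rightarrow> ('N \<Rightarrow> 'z) \<Rightarrow> real ^ 'N" where
  "cost_vector l z = (\<chi> i. l (z i))"

text \<open>Optimal value of \<open>max b\<^sup>T \<alpha>\<close> subject to \<open>A \<alpha> \<le> d\<close> (entrywise):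
  \<open>- \<infinity>\<close> if infeasible, \<open>\<infinity>\<close> if unbounded.\<close>

definition lp_max_value :: "real ^ 'r \<Rightarrow> real ^ 'r ^ 'N \<Rightarrow> real ^ 'N \<Rightarrow> ereal" where
  "lp_max_value b A d = (SUP \<alpha>\<in>{\<alpha>. A *v \<alpha> \<le> d}. ereal (\<alpha> \<bullet> b))"

end

theory Submission
  imports Defs
begin

text \<open>Since the costs are nonnegative, \<open>\<alpha> = 0\<close> is feasible, so the optimal value is finite iff
  the objective is bounded above on the feasible set. A multiplier \<open>\<mu>\<close> gives such a bound by weak
  duality. Conversely, if \<open>b\<close> lies outside the finitely generated, hence closed, cone
  \<open>{A \<mu> | \<mu> \<ge> 0}\<close>, a separating hyperplane yields a feasible ray along which the objective
  grows without bound.\<close>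

lemma axis_nonneg:
  fixes t :: real
  shows "0 \<le> t \<Longrightarrow> 0 \<le> axis i t"
  by (simp add: less_eq_vec_def axis_def)

text \<open>Describing the cone as the hull of finitely many columns makes closedness available. The
  image contains every column, as the image of a basis vector, and is itself a convex cone, so it
  contains the hull.\<close>

lemma nonneg_combinations_eq_convex_cone_hull:
  fixes A :: "real ^ 'n ^ 'm"
  shows "(*v) A ` {\<mu>. 0 \<le> \<mu>} = convex_cone hull range (\<lambda>i. column i A)"
proof
  have "A *v \<mu> \<in> convex_cone hull range (\<lambda>i. column i A)" if "0 \<le> \<mu>" for \<mu>
  proof -
    \<comment> \<open>Generalised to partial sums, so that induction can add one column at a time;
      the full index set gives \<open>A *v \<mu>\<close>.\<close>
    have "(\<Sum>i\<in>I. \<mu> $ i *\<^sub>R column i A) \<in> convex_cone hull range (\<lambda>i. column i A)" for I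
      using that
      by (induction I rule: infinite_finite_induct)
        (auto simp: less_eq_vec_def convex_cone_hull_contains_0
          intro!: convex_cone_hull_add convex_cone_hull_mul intro: hull_inc)
    then show ?thesis
      by (simp add: matrix_mult_sum scalar_mult_eq_scaleR)
  qed
  then show "(*v) A ` {\<mu>. 0 \<le> \<mu>} \<subseteq> convex_cone hull range (\<lambda>i. column i A)"
    by auto
next
  have "convex_cone {\<mu>::real ^ 'n. 0 \<le> \<mu>}"
    by (auto simp: convex_cone_iff less_eq_vec_def)
  then have "convex_cone ((*v) A ` {\<mu>. 0 \<le> \<mu>})"
    by (simp add: convex_cone_linear_image)
  moreover have "column i A \<in> (*v) A ` {\<mu>. 0 \<le> \<mu>}" for i
    by (rule image_eqI[of _ _ "axis i 1"])
      (auto simp: matrix_vector_mult_basis axis_nonneg)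
  ultimately show "convex_cone hull range (\<lambda>i. column i A) \<subseteq> (*v) A ` {\<mu>. 0 \<le> \<mu>}"
    by (intro hull_minimal) auto
qed

lemma convex_nonneg_combinations:
  fixes A :: "real ^ 'n ^ 'm"
  shows "convex ((*v) A ` {\<mu>. 0 \<le> \<mu>})"
  by (simp add: nonneg_combinations_eq_convex_cone_hull convex_convex_cone_hull)

text \<open>Closedness rests on there being only finitely many generators: the index type of the
  columns is finite.\<close>

lemma closed_nonneg_combinations:
  fixes A :: "real ^ 'n ^ 'm"
  shows "closed ((*v) A ` {\<mu>. 0 \<le> \<mu>})"
  by (simp add: nonneg_combinations_eq_convex_cone_hull closed_convex_cone_hull)

text \<open>Strict separation of \<open>b\<close> from the closed convex cone gives a vector whose
  negative is the required certificate.\<close>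

lemma farkas:
  fixes A :: "real ^ 'n ^ 'm"
  assumes "\<nexists>\<mu>. 0 \<le> \<mu> \<and> b = A *v \<mu>"
  obtains a where "transpose A *v a \<le> 0" and "a \<bullet> b > 0"
proof -
  have "b \<notin> (*v) A ` {\<mu>. 0 \<le> \<mu>}"
    using assms by auto
  from separating_hyperplane_closed_point
      [OF convex_nonneg_combinations closed_nonneg_combinations this]
  obtain a \<beta> where ab: "a \<bullet> b < \<beta>" and sep: "\<And>\<mu>. 0 \<le> \<mu> \<Longrightarrow> \<beta> < a \<bullet> (A *v \<mu>)"
    by auto
  \<comment> \<open>The cone contains 0, so the separating level lies strictly below 0.\<close>
  have "\<beta> < 0"
    using sep[of 0] by simp
  have "(transpose A *v (- a)) $ i \<le> 0" for i
  proof (rule ccontr)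
    define s where "s = (transpose A *v (- a)) $ i"
    assume "\<not> (transpose A *v (- a)) $ i \<le> 0"
    then have "s > 0" by (simp add: s_def)
    have "a \<bullet> (A *v \<mu>) = - ((transpose A *v (- a)) \<bullet> \<mu>)" for \<mu>
      using dot_lmul_matrix[of "- a" A \<mu>] by simp
    then have "a \<bullet> (A *v axis i t) = - s * t" for t
      by (simp add: inner_axis s_def)
    \<comment> \<open>Far enough along column \<open>i\<close> the functional falls to
      \<open>\<beta>\<close>: the multiple \<open>- \<beta> / s\<close> is nonnegative and attains
      \<open>\<beta>\<close> exactly, against strict separation.\<close>
    then have "\<beta> < - s * (- \<beta> / s)"
      using sep[of "axis i (- \<beta> / s)"] \<open>s > 0\<close> \<open>\<beta> < 0\<close>
      by (simp add: axis_nonneg divide_nonpos_pos)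
    then show False
      using \<open>s > 0\<close> by simp
  qed
  moreover have "- a \<bullet> b > 0"
    using ab \<open>\<beta> < 0\<close> by simp
  ultimately show thesis
    using that[of "- a"] by (simp add: less_eq_vec_def)
qed

text \<open>Pairing the constraint with \<open>\<mu>\<close> preserves the inequality, and moving
  \<open>A\<close> across the inner product turns its left side into the objective.\<close>

lemma lp_max_value_le_weak_duality:
  fixes A :: "real ^ 'n ^ 'm"
  assumes "0 \<le> \<mu>"
  shows "lp_max_value (A *v \<mu>) (transpose A) d \<le> ereal (d \<bullet> \<mu>)"
  unfolding lp_max_value_def
proof (rule SUP_least)
  fix \<alpha> assume "\<alpha> \<in> {\<alpha>. transpose A *v \<alpha> \<le> d}"
  then have "(transpose A *v \<alpha>) \<bullet> \<mu> \<le> d \<bullet> \<mu>"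
    using assms by (auto simp: inner_vec_def less_eq_vec_def intro!: sum_mono mult_right_mono)
  then show "ereal (\<alpha> \<bullet> (A *v \<mu>)) \<le> ereal (d \<bullet> \<mu>)"
    by (simp add: dot_lmul_matrix)
qed

lemma finite_lp_max_value_iff:
  fixes A :: "real ^ 'n ^ 'm"
  assumes "0 \<le> d"
  shows "\<bar>lp_max_value b (transpose A) d\<bar> \<noteq> \<infinity> \<longleftrightarrow> (\<exists>\<mu>. 0 \<le> \<mu> \<and> b = A *v \<mu>)"
proof
  assume "\<exists>\<mu>. 0 \<le> \<mu> \<and> b = A *v \<mu>"
  then obtain \<mu> where "0 \<le> \<mu>" "b = A *v \<mu>" by blast
  then have "lp_max_value b (transpose A) d \<le> ereal (d \<bullet> \<mu>)"
    using lp_max_value_le_weak_duality by blast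
  \<comment> \<open>The feasible point 0 rules out the value of an infeasible program, minus
    infinity.\<close>
  moreover have "ereal (0 \<bullet> b) \<le> lp_max_value b (transpose A) d"
    unfolding lp_max_value_def by (rule SUP_upper) (use assms in simp)
  ultimately show "\<bar>lp_max_value b (transpose A) d\<bar> \<noteq> \<infinity>"
    by auto
next
  assume finite: "\<bar>lp_max_value b (transpose A) d\<bar> \<noteq> \<infinity>"
  show "\<exists>\<mu>. 0 \<le> \<mu> \<and> b = A *v \<mu>"
  proof (rule ccontr)
    assume "\<nexists>\<mu>. 0 \<le> \<mu> \<and> b = A *v \<mu>"
    then obtain a where a: "transpose A *v a \<le> 0" "a \<bullet> b > 0"
      by (rule farkas)
    obtain v where v: "lp_max_value b (transpose A) d = ereal v"
      using finite by auto
    \<comment> \<open>Scaled so that the objective at \<open>t *\<^sub>R a\<close> is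
      \<open>\<bar>v\<bar> + 1\<close>, which exceeds the supposed optimum \<open>v\<close>.\<close>
    define t where "t = (\<bar>v\<bar> + 1) / (a \<bullet> b)"
    have "t \<ge> 0"
      using a by (simp add: t_def)
    \<comment> \<open>Along the ray the left side stays at most 0, and 0 is at most
      \<open>d\<close>.\<close>
    then have "transpose A *v (t *\<^sub>R a) \<le> d"
      using a(1) assms
      by (auto simp: less_eq_vec_def matrix_vector_mult_scaleR
          intro: order_trans[OF mult_nonneg_nonpos])
    then have "ereal ((t *\<^sub>R a) \<bullet> b) \<le> ereal v"
      unfolding v[symmetric] lp_max_value_def by (intro SUP_upper) simp
    then show False
      using a(2) by (simp add: t_def)
  qed
qed

theorem theorem1:
  fixes X :: "(real ^ 'n) set" and U :: "(real ^ 'm) set"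
    and f :: "(real ^ 'n) \<times> (real ^ 'm) \<Rightarrow> real ^ 'n"
    and l :: "(real ^ 'n) \<times> (real ^ 'm) \<Rightarrow> real"
    and \<gamma> :: real
    and \<omega> :: "(real ^ 'n) \<times> (real ^ 'm) \<Rightarrow> real"
    and \<phi> :: "(real ^ 'n) \<times> (real ^ 'm) \<Rightarrow> real ^ 'r"
    and c :: "((real ^ 'n) \<times> (real ^ 'm)) measure"
    and x xp :: "'N::finite \<Rightarrow> real ^ 'n"
    and u w :: "'N \<Rightarrow> real ^ 'm"
  defines "Z \<equiv> X \<times> U"
  defines "\<Phi> \<equiv> data_matrix \<gamma> \<phi> (\<lambda>i. (x i, u i)) (\<lambda>i. (xp i, w i))"
  assumes "f \<in> Z \<rightarrow> X"
    and "\<forall>z\<in>Z. l z \<ge> 0"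
    and "0 < \<gamma>" and "\<gamma> < 1"
    and "\<forall>z\<in>Z. \<omega> z > 0"
    and "\<forall>j. (\<lambda>z. \<phi> z $ j) \<in> weighted_functions Z \<omega>"
    and "c \<in> weighted_measures Z \<omega>"
    and "\<forall>i. x i \<in> X" and "\<forall>i. u i \<in> U" and "\<forall>i. w i \<in> U"
    and "\<forall>i. xp i = f (x i, u i)"
  shows "\<bar>lp_max_value (\<integral>z. \<phi> z \<partial>c) (transpose \<Phi>) (cost_vector l (\<lambda>i. (x i, u i)))\<bar> \<noteq> \<infinity>
    \<longleftrightarrow> (\<exists>\<mu>::real ^ 'N. 0 \<le> \<mu> \<and> (\<integral>z. \<phi> z \<partial>c) = \<Phi> *v \<mu>)"
proof -
  \<comment> \<open>Every sampled pair lies in \<open>Z\<close>, where the stage cost is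
    nonnegative.\<close>
  have "0 \<le> cost_vector l (\<lambda>i. (x i, u i))"
    using assms by (auto simp: cost_vector_def less_eq_vec_def)
  then show ?thesis
    by (rule finite_lp_max_value_iff)
qed

end
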